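(* If $f_1=f_1(x^2)$ depends only on $x^2$ and $f_2=f_2(x^3)$ depends only on $x^3$, then the following assertions are equivalent: (1) $(I,\tilde g)$ is a flat Riemannian manifold; (2) $f_1$ and $f_2$ are constant, or $f_1=k_1\in\mathbb R\setminus\{0\}$ is constant and $f_2(x^3)=\frac{c_1}{x^3-c_2}$, where $c_1\in\mathbb R\setminus\{0\}$, $c_2\in\mathbb R\setminus I_3$, or $f_2=k_2\in\mathbb R\setminus\{0\}$ is constant and $f_1(x^2)=\frac{c_1}{x^2-c_2}$, where $c_1\in\mathbb R\setminus\{0\}$, $c_2\in\mathbb R\setminus I_2$.
   Context: Let $I=I_1\times I_2\times I_3\subseteq\mathbb R^3$ with $I_1,I_2,I_3\subseteq\mathbb R$ open intervals and standard coordinates $x^1,x^2,x^3$. Let $f_1,f_2$ be smooth nowhere zero functions on $I$ and endow $I$ with the Riemannian metric $\tilde g=\frac{1}{f_1^2}dx^1\otimes dx^1+\frac{1}{f_2^2}dx^2\otimes dx^2+dx^3\otimes dx^3$. Flat means that the Riemann curvature tensor of $\tilde g$ vanishes identically. *)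

theory Defs
  imports "HOL-Analysis.Analysis"
begin

text \<open>
  Riemannian geometry on an open subset of \<open>\<real>\<^sup>n\<close>, in the standard coordinates. Vector fields are
  maps \<open>X :: real ^ 'n \<Rightarrow> real ^ 'n\<close> (the components with respect to the coordinate frame), and a
  metric \<open>g\<close> is given by its Gram matrix, \<open>g x $ i $ j\<close> being the value on the \<open>i\<close>-th and \<open>j\<close>-th
  coordinate fields at \<open>x\<close>. All derivatives are full Frechet derivatives \<open>at x\<close>, so the notions
  below are meaningful at points of an open domain.
\<close>

fun differentiable_order_on ::
  "nat \<Rightarrow> 'a::real_normed_vector set \<Rightarrow> ('a \<Rightarrow> 'b::real_normed_vector) \<Rightarrow> bool" where
  "differentiable_order_on 0 S f \<longleftrightarrow> continuous_on S f"
| "differentiable_order_on (Suc k) S f \<longleftrightarrow>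
     (\<forall>x\<in>S. f differentiable (at x)) \<and>
     (\<forall>v. differentiable_order_on k S (\<lambda>x. frechet_derivative f (at x) v))"

definition smooth_on :: "'a::real_normed_vector set \<Rightarrow> ('a \<Rightarrow> 'b::real_normed_vector) \<Rightarrow> bool" where
  "smooth_on S f \<longleftrightarrow> (\<forall>k. differentiable_order_on k S f)"

definition riemannian_metric_on :: "(real ^ 'n) set \<Rightarrow> (real ^ 'n \<Rightarrow> real ^ 'n ^ 'n) \<Rightarrow> bool" where
  "riemannian_metric_on S g \<longleftrightarrow>
     smooth_on S g \<and>
     (\<forall>x\<in>S. transpose (g x) = g x \<and> (\<forall>v. v \<noteq> 0 \<longrightarrow> 0 < v \<bullet> (g x *v v)))"

definition partial_deriv :: "'n \<Rightarrow> (real ^ 'n \<Rightarrow> real) \<Rightarrow> real ^ 'n \<Rightarrow> real" where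
  "partial_deriv i f x = frechet_derivative f (at x) (axis i 1)"

text \<open>\<open>christoffel g k i j x\<close> is \<open>\<Gamma>\<^sup>k\<^sub>i\<^sub>j\<close> at \<open>x\<close>: the first index is the upper one.\<close>

definition christoffel ::
  "(real ^ 'n \<Rightarrow> real ^ 'n ^ 'n) \<Rightarrow> 'n \<Rightarrow> 'n \<Rightarrow> 'n \<Rightarrow> real ^ 'n \<Rightarrow> real" where
  "christoffel g k i j x =
     (1/2) * (\<Sum>l\<in>UNIV. matrix_inv (g x) $ k $ l *
        (partial_deriv i (\<lambda>y. g y $ j $ l) x
         + partial_deriv j (\<lambda>y. g y $ i $ l) x
         - partial_deriv l (\<lambda>y. g y $ i $ j) x))"

text \<open>The Levi-Civita connection: \<open>levi_civita g X Y\<close> is \<open>\<nabla>\<^sub>X Y\<close>.\<close>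

definition levi_civita ::
  "(real ^ 'n \<Rightarrow> real ^ 'n ^ 'n) \<Rightarrow> (real ^ 'n \<Rightarrow> real ^ 'n) \<Rightarrow> (real ^ 'n \<Rightarrow> real ^ 'n)
     \<Rightarrow> real ^ 'n \<Rightarrow> real ^ 'n" where
  "levi_civita g X Y x =
     frechet_derivative Y (at x) (X x)
     + (\<chi> k. \<Sum>i\<in>UNIV. \<Sum>j\<in>UNIV. christoffel g k i j x * X x $ i * Y x $ j)"

definition lie_bracket ::
  "(real ^ 'n \<Rightarrow> real ^ 'n) \<Rightarrow> (real ^ 'n \<Rightarrow> real ^ 'n) \<Rightarrow> real ^ 'n \<Rightarrow> real ^ 'n" where
  "lie_bracket X Y x =
     frechet_derivative Y (at x) (X x) - frechet_derivative X (at x) (Y x)"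

definition riemann_curvature ::
  "(real ^ 'n \<Rightarrow> real ^ 'n ^ 'n) \<Rightarrow> (real ^ 'n \<Rightarrow> real ^ 'n) \<Rightarrow> (real ^ 'n \<Rightarrow> real ^ 'n)
     \<Rightarrow> (real ^ 'n \<Rightarrow> real ^ 'n) \<Rightarrow> real ^ 'n \<Rightarrow> real ^ 'n" where
  "riemann_curvature g X Y Z x =
     levi_civita g X (levi_civita g Y Z) x
     - levi_civita g Y (levi_civita g X Z) x
     - levi_civita g (lie_bracket X Y) Z x"

definition flat_riemannian :: "(real ^ 'n) set \<Rightarrow> (real ^ 'n \<Rightarrow> real ^ 'n ^ 'n) \<Rightarrow> bool" where
  "flat_riemannian S g \<longleftrightarrow>
     riemannian_metric_on S g \<and>
     (\<forall>X Y Z. smooth_on S X \<and> smooth_on S Y \<and> smooth_on S Z \<longrightarrow>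
        (\<forall>x\<in>S. riemann_curvature g X Y Z x = 0))"

definition box3 :: "real set \<Rightarrow> real set \<Rightarrow> real set \<Rightarrow> (real ^ 3) set" where
  "box3 I1 I2 I3 = {x. x $ 1 \<in> I1 \<and> x $ 2 \<in> I2 \<and> x $ 3 \<in> I3}"

definition g_tilde ::
  "(real ^ 3 \<Rightarrow> real) \<Rightarrow> (real ^ 3 \<Rightarrow> real) \<Rightarrow> real ^ 3 \<Rightarrow> real ^ 3 ^ 3" where
  "g_tilde f1 f2 x =
     (\<chi> i j. if i \<noteq> j then 0
             else if i = 1 then 1 / (f1 x)\<^sup>2
             else if i = 2 then 1 / (f2 x)\<^sup>2
             else 1)"

text \<open>\<open>f\<close> depends, on \<open>S\<close>, only on the \<open>i\<close>-th coordinate.\<close>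

definition depends_only_on :: "(real ^ 'n) set \<Rightarrow> 'n \<Rightarrow> (real ^ 'n \<Rightarrow> real) \<Rightarrow> bool" where
  "depends_only_on S i f \<longleftrightarrow> (\<forall>x\<in>S. \<forall>y\<in>S. x $ i = y $ i \<longrightarrow> f x = f y)"

end

theory Submission
  imports Defs
begin

text \<open>
  Put \<open>\<alpha> = 1 / f1\<close>, a function of \<open>x\<^sup>2\<close>, and \<open>\<beta> = 1 / f2\<close>, a function of \<open>x\<^sup>3\<close>, so that the
  metric is \<open>\<alpha>\<^sup>2 dx\<^sup>1dx\<^sup>1 + \<beta>\<^sup>2 dx\<^sup>2dx\<^sup>2 + dx\<^sup>3dx\<^sup>3\<close>. Its curvature tensor is built from
  \<open>\<alpha>''\<close>, \<open>\<beta>''\<close> and \<open>\<alpha>'\<beta>'\<close> alone and vanishes exactly when these three do. So flatness means that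
  \<open>\<alpha>\<close> and \<open>\<beta>\<close> are affine and one of them is constant; the reciprocal of a nonconstant affine
  function without zeros on the interval is \<open>c\<^sub>1 / (x - c\<^sub>2)\<close> with \<open>c\<^sub>2\<close> outside the interval.
  For arbitrary vector fields the argument needs that the curvature is a tensor, which is where the
  symmetry of second derivatives enters.
\<close>

section \<open>Derivatives of higher order\<close>

lemma frechet_derivative_eqI:
  assumes "(f has_derivative f') (at x)"
  shows "frechet_derivative f (at x) = f'"
  using frechet_derivative_at[OF assms] by simp

lemma has_derivative_frechet_derivative:
  "f differentiable (at x) \<Longrightarrow> (f has_derivative frechet_derivative f (at x)) (at x)"
  by (simp add: frechet_derivative_works)

lemma frechet_derivative_cong_open:
  assumes "open S" "x \<in> S" "\<And>y. y \<in> S \<Longrightarrow> f y = g y"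
  shows "frechet_derivative f (at x) = frechet_derivative g (at x)"
proof -
  have "(f has_derivative D) (at x) \<longleftrightarrow> (g has_derivative D) (at x)" for D
    using has_derivative_transform_within_open[OF _ assms(1,2)] assms(3) by metis
  then show ?thesis by (simp add: frechet_derivative_def)
qed

lemma differentiable_cong_open:
  assumes "open S" "x \<in> S" "\<And>y. y \<in> S \<Longrightarrow> f y = g y"
  shows "f differentiable (at x) \<longleftrightarrow> g differentiable (at x)"
proof -
  have "(f has_derivative D) (at x) \<longleftrightarrow> (g has_derivative D) (at x)" for D
    using has_derivative_transform_within_open[OF _ assms(1,2)] assms(3) by metis
  then show ?thesis by (simp add: differentiable_def)
qed

text \<open>Derivative formulas are known only at points of \<open>S\<close>; as \<open>S\<close> is
  open, equality on \<open>S\<close> passes to all iterated derivatives there. This allows computed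
  derivatives to be substituted in the recursive clause of
  \<open>differentiable_order_on\<close>.\<close>

lemma differentiable_order_on_cong_open:
  assumes "open S" "\<And>y. y \<in> S \<Longrightarrow> f y = g y"
  shows "differentiable_order_on k S f \<longleftrightarrow> differentiable_order_on k S g"
  using assms(2)
proof (induction k arbitrary: f g)
  case 0
  have "continuous_on S f \<longleftrightarrow> continuous_on S g"
    by (rule continuous_on_cong[OF refl 0])
  then show ?case by simp
next
  case (Suc k)
  have "differentiable_order_on k S (\<lambda>x. frechet_derivative f (at x) v) \<longleftrightarrow>
        differentiable_order_on k S (\<lambda>x. frechet_derivative g (at x) v)" for v
  proof (rule Suc.IH)
    show "frechet_derivative f (at y) v = frechet_derivative g (at y) v" if "y \<in> S" for y
      by (rule fun_cong[OF frechet_derivative_cong_open[OF assms(1) that Suc.prems]])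
  qed
  moreover have "f differentiable (at x) \<longleftrightarrow> g differentiable (at x)" if "x \<in> S" for x
    by (rule differentiable_cong_open[OF assms(1) that Suc.prems])
  ultimately show ?case by simp
qed

lemma differentiable_order_on_add:
  assumes "open S" "differentiable_order_on k S f" "differentiable_order_on k S g"
  shows "differentiable_order_on k S (\<lambda>x. f x + g x)"
  using assms(2,3)
proof (induction k arbitrary: f g)
  case 0
  then show ?case by (auto intro: continuous_intros)
next
  case (Suc k)
  have D: "frechet_derivative (\<lambda>x. f x + g x) (at x) v =
      frechet_derivative f (at x) v + frechet_derivative g (at x) v" if "x \<in> S" for x v
    using Suc.prems that
    by (subst frechet_derivative_eqI[OF has_derivative_add])
      (auto intro!: has_derivative_frechet_derivative)
  have "differentiable_order_on k S (\<lambda>x. frechet_derivative (\<lambda>x. f x + g x) (at x) v)" for v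
  proof (subst differentiable_order_on_cong_open[OF assms(1) D])
    show "differentiable_order_on k S
        (\<lambda>x. frechet_derivative f (at x) v + frechet_derivative g (at x) v)"
      using Suc.prems by (intro Suc.IH) auto
  qed
  then show ?case using Suc.prems by auto
qed

lemma differentiable_order_on_bounded_linear:
  assumes "open S" "bounded_linear L" "differentiable_order_on k S f"
  shows "differentiable_order_on k S (\<lambda>x. L (f x))"
  using assms(3)
proof (induction k arbitrary: f)
  case 0
  then show ?case using assms(2) by (auto intro: bounded_linear.continuous_on)
next
  case (Suc k)
  have H: "((\<lambda>x. L (f x)) has_derivative (\<lambda>v. L (frechet_derivative f (at x) v))) (at x)"
    if "x \<in> S" for x
    using Suc.prems that
    by (intro bounded_linear.has_derivative[OF assms(2)] has_derivative_frechet_derivative) auto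
  have D: "frechet_derivative (\<lambda>x. L (f x)) (at x) v = L (frechet_derivative f (at x) v)"
    if "x \<in> S" for x v
    by (simp add: frechet_derivative_eqI[OF H[OF that]])
  have "differentiable_order_on k S (\<lambda>x. frechet_derivative (\<lambda>x. L (f x)) (at x) v)" for v
  proof (subst differentiable_order_on_cong_open[OF assms(1) D])
    show "differentiable_order_on k S (\<lambda>x. L (frechet_derivative f (at x) v))"
      using Suc.prems by (intro Suc.IH) auto
  qed
  then show ?case using H by (auto simp: differentiable_def)
qed

text \<open>The class is closed under directional derivatives: differentiating along
  \<open>v\<close> gives the same shape with new coefficients and zero quadratic part. The induction
  therefore closes over arbitrary \<open>A\<close>, \<open>B\<close>, \<open>C\<close> without a
  product rule for higher orders.\<close>

lemma differentiable_order_on_quadratic: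
  fixes A B C :: "'b::real_normed_vector" and L :: "'a::real_normed_vector \<Rightarrow> real"
  assumes "bounded_linear L"
  shows "differentiable_order_on k S (\<lambda>x. A + L x *\<^sub>R B + (L x)\<^sup>2 *\<^sub>R C)"
proof (induction k arbitrary: A B C)
  case 0
  then show ?case
    by (auto intro!: continuous_intros bounded_linear.continuous_on[OF assms])
next
  case (Suc k)
  have H: "((\<lambda>x. A + L x *\<^sub>R B + (L x)\<^sup>2 *\<^sub>R C) has_derivative
      (\<lambda>v. L v *\<^sub>R B + L x *\<^sub>R (2 * L v) *\<^sub>R C)) (at x)" for x
    by (auto intro!: derivative_eq_intros bounded_linear.has_derivative[OF assms] ext
        simp: algebra_simps)
  have "differentiable_order_on k S (\<lambda>x. L v *\<^sub>R B + L x *\<^sub>R (2 * L v) *\<^sub>R C)" for v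
    using Suc.IH[of "L v *\<^sub>R B" "(2 * L v) *\<^sub>R C" 0] by simp
  then show ?case using H by (auto simp: frechet_derivative_eqI[OF H] differentiable_def)
qed

lemma smooth_on_const: "smooth_on S (\<lambda>_. c)"
  using differentiable_order_on_quadratic[OF bounded_linear_zero, of _ S c 0 0]
  by (simp add: smooth_on_def)

text \<open>Two applications of the mean value theorem, first along \<open>u\<close> to a difference
  of values of \<open>f\<close>, then along \<open>v\<close> to the derivative of \<open>f\<close>
  in direction \<open>u\<close>. The second difference on the left is symmetric in \<open>u\<close>
  and \<open>v\<close>, while the right side is a mixed derivative in a chosen order.\<close>

lemma second_difference_mean_value:
  fixes f :: "'a::real_normed_vector \<Rightarrow> real"
  assumes "differentiable_order_on 2 S f" "0 < r"
    and S: "\<And>s t. 0 \<le> s \<Longrightarrow> s \<le> r \<Longrightarrow> 0 \<le> t \<Longrightarrow> t \<le> r \<Longrightarrow> x + s *\<^sub>R u + t *\<^sub>R v \<in> S"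
  obtains \<xi> \<eta> where "0 < \<xi>" "\<xi> < r" "0 < \<eta>" "\<eta> < r"
    "f (x + r *\<^sub>R u + r *\<^sub>R v) - f (x + r *\<^sub>R u) - f (x + r *\<^sub>R v) + f x =
      r * (r * frechet_derivative (\<lambda>y. frechet_derivative f (at y) u)
        (at (x + \<xi> *\<^sub>R u + \<eta> *\<^sub>R v)) v)"
proof -
  define D where "D y = frechet_derivative f (at y) u" for y
  have f: "(f has_derivative frechet_derivative f (at y)) (at y)" if "y \<in> S" for y
    using assms(1) that by (auto simp: numeral_2_eq_2 intro!: has_derivative_frechet_derivative)
  have D: "(D has_derivative frechet_derivative D (at y)) (at y)" if "y \<in> S" for y
    using assms(1) that unfolding D_def
    by (auto simp: numeral_2_eq_2 intro!: has_derivative_frechet_derivative)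
  have line: "((\<lambda>s. h (a + s *\<^sub>R w)) has_real_derivative h' w) (at s)"
    if "(h has_derivative h') (at (a + s *\<^sub>R w))" for h :: "'a \<Rightarrow> real" and h' a w s
  proof -
    have "((\<lambda>s. h (a + s *\<^sub>R w)) has_derivative (\<lambda>t. h' (t *\<^sub>R w))) (at s)"
      by (rule has_derivative_compose[where g = h and f = "\<lambda>s. a + s *\<^sub>R w", OF _ that])
        (auto intro!: derivative_eq_intros)
    moreover have "h' (t *\<^sub>R w) = h' w * t" for t
      using has_derivative_linear[OF that] by (simp add: linear_cmul)
    ultimately show ?thesis by (simp add: has_field_derivative_def)
  qed
  have "((\<lambda>s. f (x + r *\<^sub>R v + s *\<^sub>R u) - f (x + s *\<^sub>R u)) has_real_derivative
      D (x + r *\<^sub>R v + s *\<^sub>R u) - D (x + s *\<^sub>R u)) (at s)" if "0 \<le> s" "s \<le> r" for s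
    unfolding D_def using S[of s r] S[of s 0] that assms(2)
    by (intro DERIV_diff line f) (auto simp: algebra_simps)
  from MVT2[OF assms(2), of "\<lambda>s. f (x + r *\<^sub>R v + s *\<^sub>R u) - f (x + s *\<^sub>R u)", OF this]
  obtain \<xi> where \<xi>: "0 < \<xi>" "\<xi> < r"
    "f (x + r *\<^sub>R v + r *\<^sub>R u) - f (x + r *\<^sub>R u) - (f (x + r *\<^sub>R v) - f x)
      = r * (D (x + r *\<^sub>R v + \<xi> *\<^sub>R u) - D (x + \<xi> *\<^sub>R u))"
    by auto
  have "((\<lambda>t. D (x + \<xi> *\<^sub>R u + t *\<^sub>R v)) has_real_derivative
      frechet_derivative D (at (x + \<xi> *\<^sub>R u + t *\<^sub>R v)) v) (at t)" if "0 \<le> t" "t \<le> r" for t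
    using S[of \<xi> t] that \<xi> by (intro line D) auto
  from MVT2[OF assms(2), of "\<lambda>t. D (x + \<xi> *\<^sub>R u + t *\<^sub>R v)", OF this]
  obtain \<eta> where \<eta>: "0 < \<eta>" "\<eta> < r"
    "D (x + \<xi> *\<^sub>R u + r *\<^sub>R v) - D (x + \<xi> *\<^sub>R u)
      = r * frechet_derivative D (at (x + \<xi> *\<^sub>R u + \<eta> *\<^sub>R v)) v"
    by auto
  have "f (x + r *\<^sub>R u + r *\<^sub>R v) - f (x + r *\<^sub>R u) - f (x + r *\<^sub>R v) + f x =
      r * (r * frechet_derivative D (at (x + \<xi> *\<^sub>R u + \<eta> *\<^sub>R v)) v)"
    using \<xi>(3) \<eta>(3) by (simp add: algebra_simps)
  then show thesis using that \<xi>(1,2) \<eta>(1,2) unfolding D_def by blast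
qed

text \<open>Evaluating one second difference in both orders shows that the two mixed derivatives
  agree at two points near \<open>x\<close>; their continuity at \<open>x\<close> then bounds the
  difference there by every positive \<open>e\<close>.\<close>

lemma second_frechet_derivative_commute_real:
  fixes f :: "'a::real_normed_vector \<Rightarrow> real"
  assumes "open S" "x \<in> S" and f: "differentiable_order_on 2 S f"
  shows "frechet_derivative (\<lambda>y. frechet_derivative f (at y) u) (at x) v =
    frechet_derivative (\<lambda>y. frechet_derivative f (at y) v) (at x) u"
proof -
  define D where "D u v y = frechet_derivative (\<lambda>y. frechet_derivative f (at y) u) (at y) v" for u v y
  have cont: "\<forall>\<^sub>F y in nhds x. dist (D u v y) (D u v x) < e" if "e > 0" for u v e
  proof -
    have "continuous_on S (D u v)" using f unfolding D_def by (auto simp: numeral_2_eq_2)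
    then have "(D u v \<longlongrightarrow> D u v x) (at x)"
      using assms continuous_on_eq_continuous_at isContD by blast
    then have "(D u v \<longlongrightarrow> D u v x) (nhds x)"
      by (simp add: tendsto_at_iff_tendsto_nhds)
    then show ?thesis using that by (rule tendstoD)
  qed
  have "\<bar>D u v x - D v u x\<bar> \<le> e" if "e > 0" for e
  proof -
    have "\<forall>\<^sub>F y in nhds x. y \<in> S \<and> dist (D u v y) (D u v x) < e/2 \<and> dist (D v u y) (D v u x) < e/2"
      using cont[of "e/2"] that eventually_nhds_in_open[OF assms(1,2)] by (auto simp: eventually_conj)
    then obtain d where d: "d > 0" "\<And>y. dist y x < d \<Longrightarrow>
        y \<in> S \<and> dist (D u v y) (D u v x) < e/2 \<and> dist (D v u y) (D v u x) < e/2"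
      by (auto simp: eventually_nhds_metric)
    \<comment> \<open>This size keeps the parallelogram spanned by \<open>r *\<^sub>R u\<close> and
      \<open>r *\<^sub>R v\<close> within \<open>d / 2\<close> of \<open>x\<close>; the summand 1
      keeps the denominator positive when \<open>u\<close> and \<open>v\<close> vanish.\<close>
    define r where "r = d / (2 * (norm u + norm v + 1))"
    have N: "norm u + norm v + 1 > 0" by (smt (verit) norm_ge_zero)
    have r: "r > 0" using d N by (simp add: r_def)
    have close: "dist (x + s *\<^sub>R u + t *\<^sub>R v) x < d" if "0 \<le> s" "s \<le> r" "0 \<le> t" "t \<le> r" for s t
    proof -
      have "dist (x + s *\<^sub>R u + t *\<^sub>R v) x = norm (s *\<^sub>R u + t *\<^sub>R v)" by (simp add: dist_norm)
      also have "\<dots> \<le> s * norm u + t * norm v"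
        using norm_triangle_ineq[of "s *\<^sub>R u" "t *\<^sub>R v"] that by simp
      also have "\<dots> \<le> r * norm u + r * norm v"
        using that by (intro add_mono mult_right_mono) auto
      also have "\<dots> \<le> r * (norm u + norm v + 1)" using r by (simp add: algebra_simps)
      also have "\<dots> = d / 2" using N by (simp add: r_def field_simps)
      finally show ?thesis using d(1) by simp
    qed
    have "\<And>s t. 0 \<le> s \<Longrightarrow> s \<le> r \<Longrightarrow> 0 \<le> t \<Longrightarrow> t \<le> r \<Longrightarrow> x + s *\<^sub>R u + t *\<^sub>R v \<in> S"
      using close d(2) by blast
    from second_difference_mean_value[OF f r this]
    obtain p q where pq: "0 < p" "p < r" "0 < q" "q < r"
      "f (x + r *\<^sub>R u + r *\<^sub>R v) - f (x + r *\<^sub>R u) - f (x + r *\<^sub>R v) + f x =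
        r * (r * D u v (x + p *\<^sub>R u + q *\<^sub>R v))"
      unfolding D_def by blast
    have "x + s *\<^sub>R v + t *\<^sub>R u \<in> S" if "0 \<le> s" "s \<le> r" "0 \<le> t" "t \<le> r" for s t
      using close[of t s] d(2)[of "x + t *\<^sub>R u + s *\<^sub>R v"] that by (simp add: algebra_simps)
    from second_difference_mean_value[OF f r this]
    obtain p' q' where pq': "0 < p'" "p' < r" "0 < q'" "q' < r"
      "f (x + r *\<^sub>R v + r *\<^sub>R u) - f (x + r *\<^sub>R v) - f (x + r *\<^sub>R u) + f x =
        r * (r * D v u (x + p' *\<^sub>R v + q' *\<^sub>R u))"
      unfolding D_def by blast
    \<comment> \<open>Both sides are the same second difference, so the factor \<open>r * r\<close>
      cancels.\<close>
    have "r * (r * D u v (x + p *\<^sub>R u + q *\<^sub>R v)) = r * (r * D v u (x + q' *\<^sub>R u + p' *\<^sub>R v))"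
      using pq(5) pq'(5) by (simp add: algebra_simps)
    then have "D u v (x + p *\<^sub>R u + q *\<^sub>R v) = D v u (x + q' *\<^sub>R u + p' *\<^sub>R v)" using r by simp
    moreover have "dist (D u v (x + p *\<^sub>R u + q *\<^sub>R v)) (D u v x) < e/2"
      using close[of p q] pq d(2) by simp
    moreover have "dist (D v u (x + q' *\<^sub>R u + p' *\<^sub>R v)) (D v u x) < e/2"
      using close[of q' p'] pq' d(2) by simp
    ultimately show ?thesis unfolding dist_real_def by linarith
  qed
  then have "\<bar>D u v x - D v u x\<bar> \<le> 0" by (rule field_le_epsilon) (simp)
  then show ?thesis by (simp add: D_def)
qed

text \<open>Reduces to the real case by pairing \<open>f\<close> with each fixed vector
  \<open>w\<close>, since derivatives commute with the bounded linear map
  \<open>\<lambda>z. z \<bullet> w\<close>.\<close>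

lemma second_frechet_derivative_commute:
  fixes f :: "'a::real_normed_vector \<Rightarrow> 'b::real_inner"
  assumes "open S" "x \<in> S" and f: "differentiable_order_on 2 S f"
  shows "frechet_derivative (\<lambda>y. frechet_derivative f (at y) u) (at x) v =
    frechet_derivative (\<lambda>y. frechet_derivative f (at y) v) (at x) u"
proof -
  have inner: "frechet_derivative (\<lambda>y. frechet_derivative f (at y) u) (at x) v \<bullet> w =
      frechet_derivative (\<lambda>y. frechet_derivative (\<lambda>z. f z \<bullet> w) (at y) u) (at x) v" for u v w
  proof -
    have *: "frechet_derivative (\<lambda>z. h z \<bullet> w) (at y) = (\<lambda>v. frechet_derivative h (at y) v \<bullet> w)"
      if "h differentiable (at y)" for h :: "'a \<Rightarrow> 'b" and y
      using that
      by (intro frechet_derivative_eqI has_derivative_inner_left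
          has_derivative_frechet_derivative)
    have "frechet_derivative (\<lambda>y. frechet_derivative (\<lambda>z. f z \<bullet> w) (at y) u) (at x) =
        frechet_derivative (\<lambda>y. frechet_derivative f (at y) u \<bullet> w) (at x)"
      using f by (intro frechet_derivative_cong_open[OF assms(1,2)]) (auto simp: * numeral_2_eq_2)
    also have "\<dots> = (\<lambda>v. frechet_derivative (\<lambda>y. frechet_derivative f (at y) u) (at x) v \<bullet> w)"
      using f assms(2) by (intro *) (auto simp: numeral_2_eq_2)
    finally show ?thesis by simp
  qed
  have "differentiable_order_on 2 S (\<lambda>z. f z \<bullet> w)" for w
    by (rule differentiable_order_on_bounded_linear[OF assms(1) bounded_linear_inner_left f])
  from second_frechet_derivative_commute_real[OF assms(1,2) this]
  have "frechet_derivative (\<lambda>y. frechet_derivative f (at y) u) (at x) v \<bullet> w =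
      frechet_derivative (\<lambda>y. frechet_derivative f (at y) v) (at x) u \<bullet> w" for w
    unfolding inner .
  then show ?thesis using vector_eq_rdot by blast
qed

section \<open>Curvature in terms of Christoffel symbols\<close>

text \<open>The coefficients are an argument so that the same bilinear form can carry either the
  Christoffel symbols at a point or their directional derivatives.\<close>

definition christoffel_form ::
  "('n \<Rightarrow> 'n \<Rightarrow> 'n \<Rightarrow> real) \<Rightarrow> real ^ 'n \<Rightarrow> real ^ 'n \<Rightarrow> real ^ 'n" where
  "christoffel_form c u v = (\<chi> k. \<Sum>i\<in>UNIV. \<Sum>j\<in>UNIV. c k i j * u $ i * v $ j)"

lemma christoffel_form_diff_left:
    "christoffel_form c (u - u') v = christoffel_form c u v - christoffel_form c u' v"
  and christoffel_form_add_right: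
    "christoffel_form c u (v + v') = christoffel_form c u v + christoffel_form c u v'"
  by (simp_all add: christoffel_form_def vec_eq_iff sum.distrib sum_subtractf algebra_simps)

lemma levi_civita_christoffel_form:
  "levi_civita g X Y x = frechet_derivative Y (at x) (X x)
    + christoffel_form (\<lambda>k i j. christoffel g k i j x) (X x) (Y x)"
  by (simp add: levi_civita_def christoffel_form_def)

lemma has_derivative_vec_iff:
  fixes f :: "'a::real_normed_vector \<Rightarrow> real ^ 'n"
  shows "(f has_derivative f') (at x) \<longleftrightarrow> (\<forall>k. ((\<lambda>y. f y $ k) has_derivative (\<lambda>h. f' h $ k)) (at x))"
  by (subst has_derivative_componentwise_within) (auto simp: Basis_vec_def inner_axis)

text \<open>Leibniz rule for an expression that is trilinear in the coefficients and the two
  vectors.\<close>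

lemma has_derivative_christoffel_form:
  fixes Y Z :: "'a::real_normed_vector \<Rightarrow> real ^ 'n"
  assumes c: "\<And>k i j. ((\<lambda>y. c y k i j) has_derivative (\<lambda>h. c' h k i j)) (at x)"
    and Y: "(Y has_derivative Y') (at x)" and Z: "(Z has_derivative Z') (at x)"
  shows "((\<lambda>y. christoffel_form (c y) (Y y) (Z y)) has_derivative
    (\<lambda>h. christoffel_form (c' h) (Y x) (Z x) + christoffel_form (c x) (Y' h) (Z x)
      + christoffel_form (c x) (Y x) (Z' h))) (at x)"
proof -
  have "((\<lambda>y. \<Sum>i\<in>UNIV. \<Sum>j\<in>UNIV. c y k i j * Y y $ i * Z y $ j) has_derivative
    (\<lambda>h. \<Sum>i\<in>UNIV. \<Sum>j\<in>UNIV. c' h k i j * Y x $ i * Z x $ j + c x k i j * Y' h $ i * Z x $ j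
      + c x k i j * Y x $ i * Z' h $ j)) (at x)" for k
  proof (intro has_derivative_sum)
    show "((\<lambda>y. c y k i j * Y y $ i * Z y $ j) has_derivative
      (\<lambda>h. c' h k i j * Y x $ i * Z x $ j + c x k i j * Y' h $ i * Z x $ j
        + c x k i j * Y x $ i * Z' h $ j)) (at x)" for i j
      by (rule has_derivative_eq_rhs, rule has_derivative_mult, rule has_derivative_mult, rule c)
        (use Y Z in \<open>auto simp: has_derivative_vec_iff algebra_simps\<close>)
  qed
  then show ?thesis
    by (simp add: has_derivative_vec_iff christoffel_form_def sum.distrib)
qed

text \<open>The hypothesis on \<open>Z\<close> speaks of derivatives in fixed directions only,
  whereas here the direction \<open>Y y\<close> moves with the point. Expanding it in the standard
  basis gives a finite sum of products to which the product rule applies.\<close>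

lemma has_derivative_frechet_derivative_apply:
  fixes Y :: "real ^ 'n \<Rightarrow> real ^ 'n" and Z :: "real ^ 'n \<Rightarrow> 'b::real_inner"
  assumes "open S" "x \<in> S" and Z: "differentiable_order_on 2 S Z"
    and Y: "(Y has_derivative Y') (at x)"
  shows "((\<lambda>y. frechet_derivative Z (at y) (Y y)) has_derivative
    (\<lambda>h. frechet_derivative (\<lambda>y. frechet_derivative Z (at y) (Y x)) (at x) h
      + frechet_derivative Z (at x) (Y' h))) (at x)"
proof -
  define D where "D i y = frechet_derivative Z (at y) (axis i 1)" for i y
  have D: "(D i has_derivative frechet_derivative (D i) (at x)) (at x)" for i
    using Z assms(2) unfolding D_def
    by (intro has_derivative_frechet_derivative) (auto simp: numeral_2_eq_2)
  have expand: "frechet_derivative Z (at y) v = (\<Sum>i\<in>UNIV. v $ i *\<^sub>R D i y)" if "y \<in> S" for y v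
  proof -
    have lin: "linear (frechet_derivative Z (at y))"
      using Z that by (intro linear_frechet_derivative) (auto simp: numeral_2_eq_2)
    have "v = (\<Sum>i\<in>UNIV. v $ i *\<^sub>R axis i 1)"
      using basis_expansion[of v] by (simp add: scalar_mult_eq_scaleR)
    then have "frechet_derivative Z (at y) v =
        frechet_derivative Z (at y) (\<Sum>i\<in>UNIV. v $ i *\<^sub>R axis i 1)" by simp
    also have "\<dots> = (\<Sum>i\<in>UNIV. v $ i *\<^sub>R D i y)"
      by (simp add: linear_sum[OF lin] linear_cmul[OF lin] D_def)
    finally show ?thesis .
  qed
  \<comment> \<open>With \<open>v = Y x\<close> frozen, this turns the sum of second derivatives
    back into the basis-free first summand of the claim.\<close>
  have const: "((\<lambda>y. frechet_derivative Z (at y) v) has_derivative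
      (\<lambda>h. \<Sum>i\<in>UNIV. v $ i *\<^sub>R frechet_derivative (D i) (at x) h)) (at x)" for v
  proof (rule has_derivative_transform_within_open[OF _ assms(1,2)])
    show "((\<lambda>y. \<Sum>i\<in>UNIV. v $ i *\<^sub>R D i y) has_derivative
        (\<lambda>h. \<Sum>i\<in>UNIV. v $ i *\<^sub>R frechet_derivative (D i) (at x) h)) (at x)"
      by (intro has_derivative_sum has_derivative_scaleR_right D)
  qed (simp add: expand)
  have "((\<lambda>y. \<Sum>i\<in>UNIV. Y y $ i *\<^sub>R D i y) has_derivative
      (\<lambda>h. \<Sum>i\<in>UNIV. Y x $ i *\<^sub>R frechet_derivative (D i) (at x) h + Y' h $ i *\<^sub>R D i x)) (at x)"
    using Y by (intro has_derivative_sum has_derivative_scaleR D) (simp add: has_derivative_vec_iff)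
  then have "((\<lambda>y. frechet_derivative Z (at y) (Y y)) has_derivative
      (\<lambda>h. \<Sum>i\<in>UNIV. Y x $ i *\<^sub>R frechet_derivative (D i) (at x) h + Y' h $ i *\<^sub>R D i x)) (at x)"
    by (rule has_derivative_transform_within_open[OF _ assms(1,2)]) (simp add: expand)
  then show ?thesis
    by (simp add: frechet_derivative_eqI[OF const] expand[OF assms(2)] sum.distrib)
qed

text \<open>The second derivatives of \<open>Z\<close> cancel by symmetry and its first derivatives cancel against the
  bracket term, so only the values of the fields at \<open>x\<close> remain.\<close>

lemma riemann_curvature_christoffel_form:
  fixes g :: "real ^ 'n \<Rightarrow> real ^ 'n ^ 'n"
  assumes "open S" "x \<in> S" and X: "smooth_on S X" and Y: "smooth_on S Y" and Z: "smooth_on S Z"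
    and c': "\<And>k i j. (christoffel g k i j has_derivative (\<lambda>h. c' h k i j)) (at x)"
  defines "c \<equiv> \<lambda>k i j. christoffel g k i j x"
  shows "riemann_curvature g X Y Z x =
    christoffel_form (c' (X x)) (Y x) (Z x) - christoffel_form (c' (Y x)) (X x) (Z x)
    + christoffel_form c (X x) (christoffel_form c (Y x) (Z x))
    - christoffel_form c (Y x) (christoffel_form c (X x) (Z x))"
proof -
  have deriv: "(V has_derivative frechet_derivative V (at x)) (at x)"
    if "smooth_on S V" for V :: "real ^ 'n \<Rightarrow> real ^ 'n"
  proof -
    have "differentiable_order_on (Suc 0) S V" using that unfolding smooth_on_def by blast
    then show ?thesis using assms(2) by (auto intro: has_derivative_frechet_derivative)
  qed
  have Z2: "differentiable_order_on 2 S Z" using Z by (simp add: smooth_on_def)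
  have nabla: "frechet_derivative (levi_civita g V Z) (at x) h =
      frechet_derivative (\<lambda>y. frechet_derivative Z (at y) (V x)) (at x) h
      + frechet_derivative Z (at x) (frechet_derivative V (at x) h)
      + (christoffel_form (c' h) (V x) (Z x)
        + christoffel_form c (frechet_derivative V (at x) h) (Z x)
        + christoffel_form c (V x) (frechet_derivative Z (at x) h))"
    if "smooth_on S V" for V h
  proof -
    have "(levi_civita g V Z has_derivative (\<lambda>h.
      frechet_derivative (\<lambda>y. frechet_derivative Z (at y) (V x)) (at x) h
      + frechet_derivative Z (at x) (frechet_derivative V (at x) h)
      + (christoffel_form (c' h) (V x) (Z x)
        + christoffel_form c (frechet_derivative V (at x) h) (Z x)
        + christoffel_form c (V x) (frechet_derivative Z (at x) h)))) (at x)"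
      unfolding levi_civita_christoffel_form c_def
      by (intro has_derivative_add has_derivative_frechet_derivative_apply[OF assms(1,2) Z2]
          has_derivative_christoffel_form c' deriv that Z)
    from frechet_derivative_eqI[OF this] show ?thesis by simp
  qed
  have lin: "linear (frechet_derivative Z (at x))"
    using deriv[OF Z] by (rule has_derivative_linear)
  show ?thesis
    \<comment> \<open>The outer connections are expanded first, so that their derivative terms still
      have the form covered by \<open>nabla\<close>.\<close>
    unfolding riemann_curvature_def levi_civita_christoffel_form[of g _ "levi_civita g _ Z"]
      levi_civita_christoffel_form[of g "lie_bracket X Y"] nabla[OF X] nabla[OF Y]
    unfolding levi_civita_christoffel_form lie_bracket_def c_def[symmetric]
    by (simp add: christoffel_form_add_right christoffel_form_diff_left linear_diff[OF lin]
        second_frechet_derivative_commute[OF assms(1,2) Z2, of "X x" "Y x"])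
qed

section \<open>The metric \<open>g_tilde\<close>\<close>

text \<open>\<open>matrix_inv\<close> is a choice among two-sided inverses; \<open>B\<close> shows
  that one exists, and multiplying \<open>A ** matrix_inv A = mat 1\<close> by \<open>B\<close> from
  the left identifies the chosen one.\<close>

lemma matrix_inv_unique:
  fixes A B :: "real ^ 'n ^ 'n"
  assumes "A ** B = mat 1" "B ** A = mat 1"
  shows "matrix_inv A = B"
proof -
  have "A ** matrix_inv A = mat 1"
    unfolding matrix_inv_def by (rule someI2[of _ B]) (use assms in auto)
  then show ?thesis
    by (metis assms(2) matrix_mul_assoc matrix_mul_lid matrix_mul_rid)
qed

lemma matrix_inv_diagonal:
  fixes d :: "'n::finite \<Rightarrow> real"
  assumes "\<And>i. d i \<noteq> 0"
  shows "matrix_inv (\<chi> i j. if i \<noteq> j then 0 else d i) = (\<chi> i j. if i \<noteq> j then 0 else 1 / d i)"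
proof (rule matrix_inv_unique)
  have *: "(\<chi> i j. if i \<noteq> j then 0 else p i) ** (\<chi> i j. if i \<noteq> j then 0 else q i) = mat 1"
    if "\<And>i. p i * q i = 1" for p q :: "'n \<Rightarrow> real"
  proof -
    have "(if i \<noteq> k then 0 else p i) * (if k \<noteq> j then 0 else q k)
      = (if k = i then if i = j then 1 else 0 else 0)" for i j k
      using that by auto
    then show ?thesis by (simp add: matrix_matrix_mult_def mat_def vec_eq_iff)
  qed
  show "(\<chi> i j. if i \<noteq> j then 0 else d i) ** (\<chi> i j. if i \<noteq> j then 0 else 1 / d i) = mat 1"
    "(\<chi> i j. if i \<noteq> j then 0 else 1 / d i) ** (\<chi> i j. if i \<noteq> j then 0 else d i) = mat 1"
    using assms by (auto intro!: *)
qed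

section \<open>Derivatives of functions of a single coordinate\<close>

lemma has_derivative_of_coordinate:
  fixes x :: "real ^ 'n"
  assumes "(\<phi> has_real_derivative D) (at (x $ i))"
  shows "((\<lambda>y. \<phi> (y $ i)) has_derivative (\<lambda>v. D * v $ i)) (at x)"
  using has_derivative_compose[OF bounded_linear_imp_has_derivative[OF bounded_linear_vec_nth]
      assms[unfolded has_field_derivative_def]] .

lemma partial_deriv_coordinate:
  fixes h :: "real ^ 'n \<Rightarrow> real"
  assumes "open S" "x \<in> S" "\<And>y. y \<in> S \<Longrightarrow> h y = \<phi> (y $ i)"
    and "(\<phi> has_real_derivative D) (at (x $ i))"
  shows "partial_deriv j h x = (if j = i then D else 0)"
proof -
  have "(h has_derivative (\<lambda>v. D * v $ i)) (at x)"
    by (rule has_derivative_transform_within_open[OF has_derivative_of_coordinate[OF assms(4)] assms(1,2)])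
      (simp add: assms(3))
  then show ?thesis
    by (simp add: partial_deriv_def frechet_derivative_eqI axis_def)
qed

text \<open>With \<open>\<alpha> = 1 / f1\<close> and \<open>\<beta> = 1 / f2\<close> the only Christoffel symbols of the metric that can be
  nonzero are \<open>p = \<Gamma>\<^sup>1\<^sub>1\<^sub>2 = \<Gamma>\<^sup>1\<^sub>2\<^sub>1\<close>, \<open>q = \<Gamma>\<^sup>2\<^sub>1\<^sub>1\<close>, \<open>r = \<Gamma>\<^sup>2\<^sub>2\<^sub>3 = \<Gamma>\<^sup>2\<^sub>3\<^sub>2\<close> and \<open>s = \<Gamma>\<^sup>3\<^sub>2\<^sub>2\<close>.\<close>

definition symbols3 :: "real \<Rightarrow> real \<Rightarrow> real \<Rightarrow> real \<Rightarrow> 3 \<Rightarrow> 3 \<Rightarrow> 3 \<Rightarrow> real" where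
  "symbols3 p q r s k i j =
    (if k = 1 \<and> (i = 1 \<and> j = 2 \<or> i = 2 \<and> j = 1) then p
     else if k = 2 \<and> i = 1 \<and> j = 1 then q
     else if k = 2 \<and> (i = 2 \<and> j = 3 \<or> i = 3 \<and> j = 2) then r
     else if k = 3 \<and> i = 2 \<and> j = 2 then s
     else 0)"

lemma has_derivative_symbols3:
  assumes "(p has_derivative p') (at x)" "(q has_derivative q') (at x)"
    "(r has_derivative r') (at x)" "(s has_derivative s') (at x)"
  shows "((\<lambda>y. symbols3 (p y) (q y) (r y) (s y) k i j) has_derivative
    (\<lambda>h. symbols3 (p' h) (q' h) (r' h) (s' h) k i j)) (at x)"
  using exhaust_3[of k] exhaust_3[of i] exhaust_3[of j] assms
  by (elim disjE) (simp_all add: symbols3_def)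

lemma christoffel_form_symbols3:
  "christoffel_form (symbols3 p q r s) u v =
    vector [p * (u $ 1 * v $ 2 + u $ 2 * v $ 1),
      q * u $ 1 * v $ 1 + r * (u $ 2 * v $ 3 + u $ 3 * v $ 2), s * u $ 2 * v $ 2]"
  by (simp add: christoffel_form_def symbols3_def vec_eq_iff forall_3 sum_3 algebra_simps)

text \<open>Separates the curvature computation from the origin of \<alpha> and \<beta>. It is
  interpreted once with functions obtained from arbitrary smooth \<open>f1\<close>,
  \<open>f2\<close>, and once with explicit affine functions for the converse.\<close>

locale coordinate_factors =
  fixes S :: "(real ^ 3) set" and f1 f2 :: "real ^ 3 \<Rightarrow> real" and \<alpha> \<alpha>' \<alpha>'' \<beta> \<beta>' \<beta>'' :: "real \<Rightarrow> real"
  assumes open_S: "open S"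
    and f1_eq: "x \<in> S \<Longrightarrow> 1 / f1 x = \<alpha> (x $ 2)" and f2_eq: "x \<in> S \<Longrightarrow> 1 / f2 x = \<beta> (x $ 3)"
    and \<alpha>_nonzero: "x \<in> S \<Longrightarrow> \<alpha> (x $ 2) \<noteq> 0" and \<beta>_nonzero: "x \<in> S \<Longrightarrow> \<beta> (x $ 3) \<noteq> 0"
    and \<alpha>_deriv: "x \<in> S \<Longrightarrow> (\<alpha> has_real_derivative \<alpha>' (x $ 2)) (at (x $ 2))"
    and \<alpha>'_deriv: "x \<in> S \<Longrightarrow> (\<alpha>' has_real_derivative \<alpha>'' (x $ 2)) (at (x $ 2))"
    and \<beta>_deriv: "x \<in> S \<Longrightarrow> (\<beta> has_real_derivative \<beta>' (x $ 3)) (at (x $ 3))"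
    and \<beta>'_deriv: "x \<in> S \<Longrightarrow> (\<beta>' has_real_derivative \<beta>'' (x $ 3)) (at (x $ 3))"
begin

lemma g_tilde_eq:
  assumes "x \<in> S"
  shows "g_tilde f1 f2 x =
    (\<chi> i j. if i \<noteq> j then 0 else if i = 1 then (\<alpha> (x $ 2))\<^sup>2 else if i = 2 then (\<beta> (x $ 3))\<^sup>2 else 1)"
  by (simp add: g_tilde_def vec_eq_iff power_one_over flip: f1_eq[OF assms] f2_eq[OF assms])

lemma partial_deriv_g_tilde:
  assumes "x \<in> S"
  shows "partial_deriv i (\<lambda>y. g_tilde f1 f2 y $ j $ l) x =
    (if i = 2 \<and> j = 1 \<and> l = 1 then 2 * \<alpha> (x $ 2) * \<alpha>' (x $ 2)
     else if i = 3 \<and> j = 2 \<and> l = 2 then 2 * \<beta> (x $ 3) * \<beta>' (x $ 3) else 0)"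
proof -
  consider "j = 1" "l = 1" | "j = 2" "l = 2" | "\<not> (j = 1 \<and> l = 1)" "\<not> (j = 2 \<and> l = 2)" by blast
  then show ?thesis
  proof cases
    case 1
    have "((\<lambda>t. (\<alpha> t)\<^sup>2) has_real_derivative 2 * \<alpha> (x $ 2) * \<alpha>' (x $ 2)) (at (x $ 2))"
      by (auto intro!: derivative_eq_intros \<alpha>_deriv assms)
    from partial_deriv_coordinate[OF open_S assms _ this, of "\<lambda>y. g_tilde f1 f2 y $ j $ l" i] 1
    show ?thesis by (simp add: g_tilde_eq)
  next
    case 2
    have "((\<lambda>t. (\<beta> t)\<^sup>2) has_real_derivative 2 * \<beta> (x $ 3) * \<beta>' (x $ 3)) (at (x $ 3))"
      by (auto intro!: derivative_eq_intros \<beta>_deriv assms)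
    from partial_deriv_coordinate[OF open_S assms _ this, of "\<lambda>y. g_tilde f1 f2 y $ j $ l" i] 2
    show ?thesis by (simp add: g_tilde_eq)
  next
    case 3
    \<comment> \<open>The remaining entries are constant, so they can be regarded as functions of
      the first coordinate with derivative zero.\<close>
    have "((\<lambda>t. if j = l then 1 else 0) has_real_derivative 0) (at (x $ 1))" by simp
    from partial_deriv_coordinate[OF open_S assms _ this, of "\<lambda>y. g_tilde f1 f2 y $ j $ l" i] 3
    show ?thesis by (auto simp: g_tilde_eq)
  qed
qed

lemma christoffel_g_tilde:
  assumes "x \<in> S"
  shows "christoffel (g_tilde f1 f2) k i j x =
    symbols3 (\<alpha>' (x $ 2) / \<alpha> (x $ 2)) (- (\<alpha> (x $ 2) * \<alpha>' (x $ 2) / (\<beta> (x $ 3))\<^sup>2))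
      (\<beta>' (x $ 3) / \<beta> (x $ 3)) (- (\<beta> (x $ 3) * \<beta>' (x $ 3))) k i j"
proof -
  have inv: "matrix_inv (g_tilde f1 f2 x) = (\<chi> i j. if i \<noteq> j then 0
      else 1 / (if i = 1 then (\<alpha> (x $ 2))\<^sup>2 else if i = 2 then (\<beta> (x $ 3))\<^sup>2 else 1))"
    unfolding g_tilde_eq[OF assms]
    by (rule matrix_inv_diagonal) (simp add: \<alpha>_nonzero \<beta>_nonzero assms)
  \<comment> \<open>Quantifying over the indices lets \<open>forall_3\<close> split the claim into
    explicit identities, one for each index triple.\<close>
  have "\<forall>k i j. christoffel (g_tilde f1 f2) k i j x =
    symbols3 (\<alpha>' (x $ 2) / \<alpha> (x $ 2)) (- (\<alpha> (x $ 2) * \<alpha>' (x $ 2) / (\<beta> (x $ 3))\<^sup>2))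
      (\<beta>' (x $ 3) / \<beta> (x $ 3)) (- (\<beta> (x $ 3) * \<beta>' (x $ 3))) k i j"
    using \<alpha>_nonzero[OF assms] \<beta>_nonzero[OF assms]
    by (simp add: christoffel_def inv partial_deriv_g_tilde[OF assms] symbols3_def forall_3 sum_3
        power2_eq_square)
  then show ?thesis by blast
qed

text \<open>Expressed through the logarithmic derivatives \<open>p\<close>, \<open>r\<close> and the quotients \<open>A\<close>, \<open>B\<close>, the
  Christoffel symbols and their derivatives are polynomial, which keeps the curvature computation a
  ring identity.\<close>

lemma riemann_curvature_g_tilde:
  fixes X Y Z :: "real ^ 3 \<Rightarrow> real ^ 3"
  assumes x: "x \<in> S" and smooth: "smooth_on S X" "smooth_on S Y" "smooth_on S Z"
  defines "p \<equiv> \<alpha>' (x $ 2) / \<alpha> (x $ 2)" and "r \<equiv> \<beta>' (x $ 3) / \<beta> (x $ 3)"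
    and "A \<equiv> \<alpha>'' (x $ 2) / \<alpha> (x $ 2)" and "B \<equiv> \<beta>'' (x $ 3) / \<beta> (x $ 3)"
    and "w \<equiv> \<lambda>i j. X x $ i * Y x $ j - X x $ j * Y x $ i"
    and "c \<equiv> (\<alpha> (x $ 2) / \<beta> (x $ 3))\<^sup>2" and "d \<equiv> (\<beta> (x $ 3))\<^sup>2"
  shows "riemann_curvature (g_tilde f1 f2) X Y Z x = vector
        [p * r * (w 1 3 * Z x $ 2 + w 1 2 * Z x $ 3) - A * w 1 2 * Z x $ 2,
         c * (A * w 1 2 - p * r * w 1 3) * Z x $ 1 - B * w 2 3 * Z x $ 3,
         d * (B * w 2 3 * Z x $ 2 - c * p * r * w 1 2 * Z x $ 1)]"
proof -
  note nz = \<alpha>_nonzero[OF x] \<beta>_nonzero[OF x]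
  note D = has_derivative_of_coordinate[OF \<alpha>_deriv[OF x]] has_derivative_of_coordinate[OF \<alpha>'_deriv[OF x]]
    has_derivative_of_coordinate[OF \<beta>_deriv[OF x]] has_derivative_of_coordinate[OF \<beta>'_deriv[OF x]]
  have p: "((\<lambda>y. \<alpha>' (y $ 2) / \<alpha> (y $ 2)) has_derivative (\<lambda>h. (A - p\<^sup>2) * h $ 2)) (at x)"
    by (rule has_derivative_eq_rhs, rule has_derivative_divide, rule D, rule D)
      (use nz in \<open>auto simp: p_def A_def field_simps power2_eq_square fun_eq_iff\<close>)
  \<comment> \<open>The function is \<open>- c * p\<close> at \<open>x\<close>; differentiating the
    numerator gives the term with \<open>p\<^sup>2 + A\<close>, and differentiating the denominator
    gives the term with \<open>2 * p * r\<close>.\<close>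
  have q: "((\<lambda>y. - (\<alpha> (y $ 2) * \<alpha>' (y $ 2) / (\<beta> (y $ 3))\<^sup>2)) has_derivative
      (\<lambda>h. c * (2 * p * r * h $ 3 - (p\<^sup>2 + A) * h $ 2))) (at x)"
    by (rule has_derivative_eq_rhs, rule has_derivative_minus, rule has_derivative_divide,
        rule has_derivative_mult, rule D, rule D, rule has_derivative_power, rule D)
      (use nz in \<open>auto simp: p_def r_def A_def c_def field_simps power2_eq_square fun_eq_iff\<close>)
  have r: "((\<lambda>y. \<beta>' (y $ 3) / \<beta> (y $ 3)) has_derivative (\<lambda>h. (B - r\<^sup>2) * h $ 3)) (at x)"
    by (rule has_derivative_eq_rhs, rule has_derivative_divide, rule D, rule D)
      (use nz in \<open>auto simp: r_def B_def field_simps power2_eq_square fun_eq_iff\<close>)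
  have s: "((\<lambda>y. - (\<beta> (y $ 3) * \<beta>' (y $ 3))) has_derivative (\<lambda>h. - d * (r\<^sup>2 + B) * h $ 3)) (at x)"
    by (rule has_derivative_eq_rhs, rule has_derivative_minus, rule has_derivative_mult, rule D, rule D)
      (use nz in \<open>auto simp: r_def B_def d_def field_simps power2_eq_square fun_eq_iff\<close>)
  have deriv: "(christoffel (g_tilde f1 f2) k i j has_derivative
        (\<lambda>h. symbols3 ((A - p\<^sup>2) * h $ 2) (c * (2 * p * r * h $ 3 - (p\<^sup>2 + A) * h $ 2))
          ((B - r\<^sup>2) * h $ 3) (- d * (r\<^sup>2 + B) * h $ 3) k i j)) (at x)"
    for k i j
    by (rule has_derivative_transform_within_open[OF has_derivative_symbols3[OF p q r s] open_S x])
      (simp add: christoffel_g_tilde)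
  have symbols: "(\<lambda>k i j. christoffel (g_tilde f1 f2) k i j x) = symbols3 p (- c * p) r (- d * r)"
    unfolding christoffel_g_tilde[OF x] using nz
    by (simp add: p_def r_def c_def d_def power2_eq_square fun_eq_iff)
  \<comment> \<open>The squares of \<open>p\<close> and \<open>r\<close> coming from the derivatives
    cancel against products of Christoffel symbols, which leaves only \<open>A\<close>,
    \<open>B\<close> and \<open>p * r\<close>.\<close>
  show ?thesis
    unfolding riemann_curvature_christoffel_form[OF open_S x smooth deriv] symbols
      christoffel_form_symbols3 w_def
    by (simp add: vec_eq_iff forall_3) (simp add: algebra_simps power2_eq_square)
qed

end

section \<open>Flatness\<close>

text \<open>A zero derivative on an interval forces constancy, first of \<open>\<phi>'\<close> and
  then of \<open>\<phi> t - n * t\<close>. The slope is also returned as the value of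
  \<open>\<phi>'\<close>, because the condition on \<open>\<alpha>' * \<beta>'\<close> is to be read
  as one on slopes.\<close>

lemma affine_of_second_derivative_zero:
  fixes \<phi> \<phi>' :: "real \<Rightarrow> real"
  assumes "is_interval J" and "\<And>t. t \<in> J \<Longrightarrow> (\<phi> has_real_derivative \<phi>' t) (at t)"
    and "\<And>t. t \<in> J \<Longrightarrow> (\<phi>' has_real_derivative 0) (at t)"
  obtains m n where "\<And>t. t \<in> J \<Longrightarrow> \<phi> t = m + n * t" "\<And>t. t \<in> J \<Longrightarrow> \<phi>' t = n"
proof -
  have J: "convex J" using assms(1) by (simp add: is_interval_convex)
  obtain n where n: "\<And>t. t \<in> J \<Longrightarrow> \<phi>' t = n"
    using has_field_derivative_zero_constant[OF J, of \<phi>'] assms(3)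
    by (meson has_field_derivative_at_within)
  have "((\<lambda>t. \<phi> t - n * t) has_real_derivative 0) (at t within J)" if "t \<in> J" for t
    by (rule has_field_derivative_at_within) (use assms(2)[OF that] n[OF that] in
        \<open>auto intro!: derivative_eq_intros\<close>)
  from has_field_derivative_zero_constant[OF J this]
  obtain m where "\<forall>t\<in>J. \<phi> t - n * t = m" by blast
  then show thesis using n by (intro that[of m n]) (auto simp: algebra_simps)
qed

text \<open>A function of the \<open>i\<close>-th coordinate alone is determined by its restriction
  to a line through \<open>p\<close> parallel to the \<open>i\<close>-th axis. The chain rule along
  that line turns partial derivatives of \<open>f\<close> into ordinary derivatives of the
  restriction.\<close>

lemma smooth_function_of_coordinate:
  fixes f :: "real ^ 'n \<Rightarrow> real"
  assumes "smooth_on S f" and "depends_only_on S i f" and "p \<in> S"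
    and line: "\<And>t. t \<in> J \<Longrightarrow> p + (t - p $ i) *\<^sub>R axis i 1 \<in> S" and J: "\<And>x. x \<in> S \<Longrightarrow> x $ i \<in> J"
  obtains \<phi> \<phi>' \<phi>'' where "\<And>x. x \<in> S \<Longrightarrow> f x = \<phi> (x $ i)"
    "\<And>t. t \<in> J \<Longrightarrow> (\<phi> has_real_derivative \<phi>' t) (at t)"
    "\<And>t. t \<in> J \<Longrightarrow> (\<phi>' has_real_derivative \<phi>'' t) (at t)"
proof -
  define \<gamma> where "\<gamma> t = p + (t - p $ i) *\<^sub>R axis i (1::real)" for t
  define D where "D x = frechet_derivative f (at x) (axis i 1)" for x
  have along: "((\<lambda>t. h (\<gamma> t)) has_real_derivative frechet_derivative h (at (\<gamma> t)) (axis i 1)) (at t)"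
    if "h differentiable (at (\<gamma> t))" for h :: "real ^ 'n \<Rightarrow> real" and t
  proof -
    have "(\<gamma> has_derivative (\<lambda>s. s *\<^sub>R axis i 1)) (at t)"
      unfolding \<gamma>_def by (auto intro!: derivative_eq_intros)
    from has_derivative_compose[OF this has_derivative_frechet_derivative[OF that]]
    have "((\<lambda>t. h (\<gamma> t)) has_derivative (\<lambda>s. s * frechet_derivative h (at (\<gamma> t)) (axis i 1))) (at t)"
      by (simp add: linear_cmul[OF linear_frechet_derivative[OF that]])
    then show ?thesis by (simp add: has_field_derivative_def mult_commute_abs)
  qed
  have "differentiable_order_on 2 S f" using assms(1) by (simp add: smooth_on_def)
  then have diff: "f differentiable (at (\<gamma> t))" "D differentiable (at (\<gamma> t))" if "t \<in> J" for t
    using line[OF that] by (auto simp: numeral_2_eq_2 D_def[abs_def] \<gamma>_def)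
  show thesis
  proof (rule that[of "\<lambda>t. f (\<gamma> t)" "\<lambda>t. D (\<gamma> t)"])
    show "f x = f (\<gamma> (x $ i))" if "x \<in> S" for x
    proof -
      have "\<gamma> (x $ i) \<in> S" using line[OF J[OF that]] by (simp add: \<gamma>_def)
      moreover have "x $ i = \<gamma> (x $ i) $ i" by (simp add: \<gamma>_def)
      ultimately show ?thesis using assms(2) that unfolding depends_only_on_def by blast
    qed
    show "((\<lambda>t. f (\<gamma> t)) has_real_derivative D (\<gamma> t)) (at t)" if "t \<in> J" for t
      unfolding D_def by (rule along[OF diff(1)[OF that]])
    show "((\<lambda>t. D (\<gamma> t)) has_real_derivative frechet_derivative D (at (\<gamma> t)) (axis i 1)) (at t)"
      if "t \<in> J" for t
      by (rule along[OF diff(2)[OF that]])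
  qed
qed

lemma smooth_reciprocal_of_coordinate:
  fixes f :: "real ^ 'n \<Rightarrow> real"
  assumes "smooth_on S f" and "depends_only_on S i f" and "p \<in> S" and "\<forall>x\<in>S. f x \<noteq> 0"
    and line: "\<And>t. t \<in> J \<Longrightarrow> p + (t - p $ i) *\<^sub>R axis i 1 \<in> S" and J: "\<And>x. x \<in> S \<Longrightarrow> x $ i \<in> J"
  obtains \<alpha> \<alpha>' \<alpha>'' where "\<And>x. x \<in> S \<Longrightarrow> 1 / f x = \<alpha> (x $ i)" "\<And>t. t \<in> J \<Longrightarrow> \<alpha> t \<noteq> 0"
    "\<And>t. t \<in> J \<Longrightarrow> (\<alpha> has_real_derivative \<alpha>' t) (at t)"
    "\<And>t. t \<in> J \<Longrightarrow> (\<alpha>' has_real_derivative \<alpha>'' t) (at t)"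
proof -
  obtain \<phi> \<phi>' \<phi>'' where \<phi>: "\<And>x. x \<in> S \<Longrightarrow> f x = \<phi> (x $ i)"
    "\<And>t. t \<in> J \<Longrightarrow> (\<phi> has_real_derivative \<phi>' t) (at t)"
    "\<And>t. t \<in> J \<Longrightarrow> (\<phi>' has_real_derivative \<phi>'' t) (at t)"
    using smooth_function_of_coordinate[OF assms(1-3) line J] by blast
  \<comment> \<open>Each \<open>t\<close> in \<open>J\<close> is the \<open>i\<close>-th coordinate
    of a point of the line inside \<open>S\<close>, so nonvanishing on \<open>S\<close> carries over
    to \<open>J\<close>.\<close>
  have nz: "\<phi> t \<noteq> 0" if "t \<in> J" for t
    using assms(4) line[OF that] \<phi>(1)[OF line[OF that]] by (auto simp: axis_def)
  show thesis
  proof (rule that[of "\<lambda>t. 1 / \<phi> t" "\<lambda>t. - \<phi>' t / (\<phi> t)\<^sup>2"])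
    show "((\<lambda>t. 1 / \<phi> t) has_real_derivative - \<phi>' t / (\<phi> t)\<^sup>2) (at t)" if "t \<in> J" for t
      using nz[OF that] \<phi>(2)[OF that]
      by (auto intro!: derivative_eq_intros simp: power2_eq_square)
    show "((\<lambda>t. - \<phi>' t / (\<phi> t)\<^sup>2) has_real_derivative
        (- \<phi>'' t * (\<phi> t)\<^sup>2 + \<phi>' t * (2 * \<phi> t * \<phi>' t)) / ((\<phi> t)\<^sup>2 * (\<phi> t)\<^sup>2)) (at t)" if "t \<in> J" for t
      using nz[OF that] \<phi>(2,3)[OF that]
      by (auto intro!: derivative_eq_intros simp: field_simps)
  qed (use \<phi>(1) nz in auto)
qed

section \<open>Flatness as differential equations for \<alpha> and \<beta>\<close>

context coordinate_factors
begin

lemma flat_g_tildeD: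
  assumes "flat_riemannian S (g_tilde f1 f2)" "x \<in> S"
  shows "\<alpha>'' (x $ 2) = 0" "\<beta>'' (x $ 3) = 0" "\<alpha>' (x $ 2) * \<beta>' (x $ 3) = 0"
proof -
  have R: "riemann_curvature (g_tilde f1 f2) (\<lambda>_. axis i 1) (\<lambda>_. axis j 1) (\<lambda>_. axis k 1) x = 0"
    for i j k
    using assms smooth_on_const[of S "axis i 1 :: real ^ 3"] smooth_on_const[of S "axis j 1 :: real ^ 3"]
      smooth_on_const[of S "axis k 1 :: real ^ 3"]
    unfolding flat_riemannian_def by blast
  note R = R[unfolded riemann_curvature_g_tilde[OF assms(2) smooth_on_const smooth_on_const smooth_on_const]
      vec_eq_iff forall_3]
  \<comment> \<open>Each choice of constant coordinate fields isolates one coefficient of the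
    curvature: the triples 1 2 2, 2 3 3 and 1 2 3 yield \<open>A\<close>, \<open>B\<close> and
    \<open>p * r\<close> respectively, up to sign.\<close>
  show "\<alpha>'' (x $ 2) = 0" using R[of 1 2 2] \<alpha>_nonzero[OF assms(2)] by (simp add: axis_def)
  show "\<beta>'' (x $ 3) = 0" using R[of 2 3 3] \<beta>_nonzero[OF assms(2)] by (simp add: axis_def)
  show "\<alpha>' (x $ 2) * \<beta>' (x $ 3) = 0"
    using R[of 1 2 3] \<alpha>_nonzero[OF assms(2)] \<beta>_nonzero[OF assms(2)] by (simp add: axis_def)
qed

text \<open>Smoothness of the metric is a hypothesis because the locale supplies only two
  derivatives of \<alpha> and \<beta>. Positivity holds because the quadratic form is a sum of
  squares with nonzero weights.\<close>

lemma flat_g_tildeI: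
  assumes "smooth_on S (g_tilde f1 f2)"
    and "\<And>x. x \<in> S \<Longrightarrow> \<alpha>'' (x $ 2) = 0 \<and> \<beta>'' (x $ 3) = 0 \<and> \<alpha>' (x $ 2) * \<beta>' (x $ 3) = 0"
  shows "flat_riemannian S (g_tilde f1 f2)"
  unfolding flat_riemannian_def riemannian_metric_on_def
proof (intro conjI assms(1) ballI allI impI)
  fix x assume x: "x \<in> S"
  show "transpose (g_tilde f1 f2 x) = g_tilde f1 f2 x"
    by (auto simp: g_tilde_def transpose_def vec_eq_iff)
  fix v :: "real ^ 3" assume "v \<noteq> 0"
  then have v: "v $ 1 \<noteq> 0 \<or> v $ 2 \<noteq> 0 \<or> v $ 3 \<noteq> 0" by (auto simp: vec_eq_iff forall_3)
  have "v \<bullet> (g_tilde f1 f2 x *v v) =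
      (\<alpha> (x $ 2) * v $ 1)\<^sup>2 + (\<beta> (x $ 3) * v $ 2)\<^sup>2 + (v $ 3)\<^sup>2"
    by (simp add: g_tilde_eq[OF x] inner_vec_def matrix_vector_mult_def sum_3 power2_eq_square)
  also have "\<dots> > 0"
    using v \<alpha>_nonzero[OF x] \<beta>_nonzero[OF x]
    by (elim disjE) (simp_all add: add_pos_nonneg add_nonneg_pos)
  finally show "0 < v \<bullet> (g_tilde f1 f2 x *v v)" .
next
  fix X Y Z :: "real ^ 3 \<Rightarrow> real ^ 3" and x
  assume "smooth_on S X \<and> smooth_on S Y \<and> smooth_on S Z" and x: "x \<in> S"
  then show "riemann_curvature (g_tilde f1 f2) X Y Z x = 0"
    using assms(2)[OF x]
    by (subst riemann_curvature_g_tilde[OF x]) (auto simp: vec_eq_iff forall_3)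
qed

end

text \<open>The square of an affine function is a quadratic polynomial, so the metric is the sum of
  a quadratic in \<open>x $ 2\<close> and a quadratic in \<open>x $ 3\<close> with matrix
  coefficients. The constant entry \<open>E 3\<close> is put into the second one.\<close>

lemma smooth_on_g_tilde_affine:
  assumes "open S" and "\<And>x. x \<in> S \<Longrightarrow> 1 / f1 x = m1 + n1 * x $ 2"
    and "\<And>x. x \<in> S \<Longrightarrow> 1 / f2 x = m2 + n2 * x $ 3"
  shows "smooth_on S (g_tilde f1 f2)"
proof -
  define E :: "3 \<Rightarrow> real ^ 3 ^ 3" where "E k = (\<chi> i j. if i = k \<and> j = k then 1 else 0)" for k
  have eq: "g_tilde f1 f2 x =
      (m1\<^sup>2 *\<^sub>R E 1 + x $ 2 *\<^sub>R ((2 * m1 * n1) *\<^sub>R E 1) + (x $ 2)\<^sup>2 *\<^sub>R (n1\<^sup>2 *\<^sub>R E 1)) +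
      ((m2\<^sup>2 *\<^sub>R E 2 + E 3) + x $ 3 *\<^sub>R ((2 * m2 * n2) *\<^sub>R E 2) + (x $ 3)\<^sup>2 *\<^sub>R (n2\<^sup>2 *\<^sub>R E 2))"
    if "x \<in> S" for x
  proof -
    have "1 / (f1 x)\<^sup>2 = (m1 + n1 * x $ 2)\<^sup>2" "1 / (f2 x)\<^sup>2 = (m2 + n2 * x $ 3)\<^sup>2"
      by (simp_all add: power_one_over flip: assms(2,3)[OF that])
    then show ?thesis
      by (simp add: g_tilde_def E_def vec_eq_iff forall_3 power2_sum)
        (simp add: algebra_simps power2_eq_square)
  qed
  have "differentiable_order_on k S (g_tilde f1 f2)" for k
    by (intro differentiable_order_on_cong_open[OF assms(1) eq, THEN iffD2]
        differentiable_order_on_add[OF assms(1)] differentiable_order_on_quadratic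
        bounded_linear_vec_nth)
  then show ?thesis by (simp add: smooth_on_def)
qed

text \<open>A common form of the three alternatives in the classification: affine reciprocals, at
  least one of which has slope zero.\<close>

lemma flat_g_tilde_affine:
  assumes "open S" and "\<forall>x\<in>S. f1 x \<noteq> 0" "\<forall>x\<in>S. f2 x \<noteq> 0"
    and f1: "\<And>x. x \<in> S \<Longrightarrow> 1 / f1 x = m1 + n1 * x $ 2"
    and f2: "\<And>x. x \<in> S \<Longrightarrow> 1 / f2 x = m2 + n2 * x $ 3" and "n1 * n2 = 0"
  shows "flat_riemannian S (g_tilde f1 f2)"
proof -
  interpret coordinate_factors S f1 f2 "\<lambda>t. m1 + n1 * t" "\<lambda>_. n1" "\<lambda>_. 0" "\<lambda>t. m2 + n2 * t" "\<lambda>_. n2" "\<lambda>_. 0"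
  proof
    show "m1 + n1 * x $ 2 \<noteq> 0" "m2 + n2 * x $ 3 \<noteq> 0" if "x \<in> S" for x
      using assms(2,3) that f1[OF that] f2[OF that] by (metis divide_eq_0_iff zero_neq_one)+
  qed (auto intro!: derivative_eq_intros simp: assms)
  show ?thesis
    by (rule flat_g_tildeI[OF smooth_on_g_tilde_affine[OF assms(1) f1 f2]]) (use assms(6) in auto)
qed

section \<open>Classification on a box\<close>

lemma open_box3:
  assumes "open I1" "open I2" "open I3"
  shows "open (box3 I1 I2 I3)"
proof -
  have "box3 I1 I2 I3 = (\<lambda>x. x $ 1) -` I1 \<inter> (\<lambda>x. x $ 2) -` I2 \<inter> (\<lambda>x. x $ 3) -` I3"
    by (auto simp: box3_def)
  then show ?thesis using assms by (auto intro!: open_Int open_vimage continuous_intros)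
qed

theorem proposition2p10:
  fixes I1 I2 I3 :: "real set" and I :: "(real ^ 3) set" and f1 f2 :: "real ^ 3 \<Rightarrow> real"
  assumes "open I1" "is_interval I1"
    and "open I2" "is_interval I2"
    and "open I3" "is_interval I3"
    and "I = box3 I1 I2 I3"
    and "smooth_on I f1" "\<forall>x\<in>I. f1 x \<noteq> 0"
    and "smooth_on I f2" "\<forall>x\<in>I. f2 x \<noteq> 0"
    and "depends_only_on I 2 f1"
    and "depends_only_on I 3 f2"
  shows "flat_riemannian I (g_tilde f1 f2) \<longleftrightarrow>
    (f1 constant_on I \<and> f2 constant_on I)
    \<or> (\<exists>k1 c1 c2. k1 \<noteq> 0 \<and> c1 \<noteq> 0 \<and> c2 \<notin> I3 \<and>
         (\<forall>x\<in>I. f1 x = k1 \<and> f2 x = c1 / (x $ 3 - c2)))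
    \<or> (\<exists>k2 c1 c2. k2 \<noteq> 0 \<and> c1 \<noteq> 0 \<and> c2 \<notin> I2 \<and>
         (\<forall>x\<in>I. f2 x = k2 \<and> f1 x = c1 / (x $ 2 - c2)))"
  (is "?flat \<longleftrightarrow> ?const \<or> ?f2 \<or> ?f1")
proof
  have open_I: "open I" using assms(1,3,5,7) by (simp add: open_box3)
  note affine = flat_g_tilde_affine[OF open_I assms(9,11)]
  assume "?const \<or> ?f2 \<or> ?f1"
  then show ?flat
  proof (elim disjE)
    assume ?const
    then obtain k1 k2 where "\<forall>x\<in>I. f1 x = k1" "\<forall>x\<in>I. f2 x = k2" by (auto simp: constant_on_def)
    then show ?flat by (intro affine[of "1 / k1" 0 "1 / k2" 0]) auto
  next
    assume ?f2
    then obtain k1 c1 c2 where "\<forall>x\<in>I. f1 x = k1 \<and> f2 x = c1 / (x $ 3 - c2)" by blast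
    then show ?flat
      \<comment> \<open>The witnesses are read off from
        \<open>1 / f2 x = (x $ 3 - c2) / c1\<close>.\<close>
      by (intro affine[of "1 / k1" 0 "- c2 / c1" "1 / c1"]) (auto simp: diff_divide_distrib)
  next
    assume ?f1
    then obtain k2 c1 c2 where "\<forall>x\<in>I. f2 x = k2 \<and> f1 x = c1 / (x $ 2 - c2)" by blast
    then show ?flat
      by (intro affine[of "- c2 / c1" "1 / c1" "1 / k2" 0]) (auto simp: diff_divide_distrib)
  qed
next
  have open_I: "open I" using assms(1,3,5,7) by (simp add: open_box3)
  assume flat: ?flat
  show "?const \<or> ?f2 \<or> ?f1"
  \<comment> \<open>The intervals may be empty, and then constancy is vacuous. Otherwise a point
    \<open>p\<close> of the box provides the coordinate lines used to reduce to one
    variable.\<close>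
  proof (cases "I = {}")
    case True
    then show ?thesis by (simp add: constant_on_def)
  next
    case False
    then obtain p where p: "p \<in> I" by blast
    have line2: "p + (t - p $ 2) *\<^sub>R axis 2 1 \<in> I" if "t \<in> I2" for t
      using p that by (simp add: assms(7) box3_def axis_def)
    have line3: "p + (t - p $ 3) *\<^sub>R axis 3 1 \<in> I" if "t \<in> I3" for t
      using p that by (simp add: assms(7) box3_def axis_def)
    have coords: "x $ 2 \<in> I2" "x $ 3 \<in> I3" if "x \<in> I" for x
      using that by (simp_all add: assms(7) box3_def)
    obtain \<alpha> \<alpha>' \<alpha>'' where \<alpha>: "\<And>x. x \<in> I \<Longrightarrow> 1 / f1 x = \<alpha> (x $ 2)" "\<And>t. t \<in> I2 \<Longrightarrow> \<alpha> t \<noteq> 0"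
      "\<And>t. t \<in> I2 \<Longrightarrow> (\<alpha> has_real_derivative \<alpha>' t) (at t)"
      "\<And>t. t \<in> I2 \<Longrightarrow> (\<alpha>' has_real_derivative \<alpha>'' t) (at t)"
      using smooth_reciprocal_of_coordinate[OF assms(8,12) p assms(9) line2 coords(1)] by blast
    obtain \<beta> \<beta>' \<beta>'' where \<beta>: "\<And>x. x \<in> I \<Longrightarrow> 1 / f2 x = \<beta> (x $ 3)" "\<And>t. t \<in> I3 \<Longrightarrow> \<beta> t \<noteq> 0"
      "\<And>t. t \<in> I3 \<Longrightarrow> (\<beta> has_real_derivative \<beta>' t) (at t)"
      "\<And>t. t \<in> I3 \<Longrightarrow> (\<beta>' has_real_derivative \<beta>'' t) (at t)"
      using smooth_reciprocal_of_coordinate[OF assms(10,13) p assms(11) line3 coords(2)] by blast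
    interpret coordinate_factors I f1 f2 \<alpha> \<alpha>' \<alpha>'' \<beta> \<beta>' \<beta>''
      by unfold_locales (use open_I \<alpha> \<beta> coords in auto)
    \<comment> \<open>Flatness is evaluated at the point of the line through \<open>p\<close> whose
      second coordinate is \<open>t\<close>.\<close>
    have "\<alpha>'' t = 0" if "t \<in> I2" for t
      using flat_g_tildeD(1)[OF flat line2[OF that]] by (simp add: axis_def)
    then obtain m1 n1 where 1: "\<And>t. t \<in> I2 \<Longrightarrow> \<alpha> t = m1 + n1 * t" "\<And>t. t \<in> I2 \<Longrightarrow> \<alpha>' t = n1"
      using affine_of_second_derivative_zero[OF assms(4) \<alpha>(3)] \<alpha>(4) by metis
    have "\<beta>'' t = 0" if "t \<in> I3" for t
      using flat_g_tildeD(2)[OF flat line3[OF that]] by (simp add: axis_def)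
    then obtain m2 n2 where 2: "\<And>t. t \<in> I3 \<Longrightarrow> \<beta> t = m2 + n2 * t" "\<And>t. t \<in> I3 \<Longrightarrow> \<beta>' t = n2"
      using affine_of_second_derivative_zero[OF assms(6) \<beta>(3)] \<beta>(4) by metis
    have f1: "f1 x = 1 / (m1 + n1 * x $ 2)" if "x \<in> I" for x
      using \<alpha>(1)[OF that] 1(1)[OF coords(1)[OF that]] by (metis div_by_1 divide_divide_eq_right mult_1)
    have f2: "f2 x = 1 / (m2 + n2 * x $ 3)" if "x \<in> I" for x
      using \<beta>(1)[OF that] 2(1)[OF coords(2)[OF that]] by (metis div_by_1 divide_divide_eq_right mult_1)
    \<comment> \<open>An affine function with nonzero slope vanishes at this point, whereas \<alpha>
      has no zero on \<open>I2\<close>.\<close>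
    have pole1: "- m1 / n1 \<notin> I2" if "n1 \<noteq> 0"
      using \<alpha>(2)[of "- m1 / n1"] 1(1)[of "- m1 / n1"] that by auto
    have pole2: "- m2 / n2 \<notin> I3" if "n2 \<noteq> 0"
      using \<beta>(2)[of "- m2 / n2"] 2(1)[of "- m2 / n2"] that by auto
    \<comment> \<open>The derivatives are constant on the intervals, so the product condition at the
      single point \<open>p\<close> settles the slopes.\<close>
    have n: "n1 * n2 = 0"
      using flat_g_tildeD(3)[OF flat p] 1(2)[OF coords(1)[OF p]] 2(2)[OF coords(2)[OF p]] by simp
    \<comment> \<open>This supplies the constants of the statement: \<open>c1 = 1 / n\<close> and
      \<open>c2 = - m / n\<close>, the latter being the point excluded by \<open>pole1\<close> or
      \<open>pole2\<close>.\<close>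
    have hyperbola: "1 / (m + n * t) = (1 / n) / (t - (- m / n))" if "n \<noteq> 0" for m n t :: real
      using that by (simp add: field_simps)
    consider "n1 = 0" "n2 = 0" | "n1 = 0" "n2 \<noteq> 0" | "n1 \<noteq> 0" "n2 = 0" using n by auto
    then show ?thesis
    proof cases
      case 1
      then have ?const using f1 f2 by (simp add: constant_on_def)
      then show ?thesis by blast
    next
      case 2
      have "1 / m1 \<noteq> 0" using f1[OF p] 2 assms(9) p by auto
      moreover have "\<forall>x\<in>I. f1 x = 1 / m1 \<and> f2 x = (1 / n2) / (x $ 3 - (- m2 / n2))"
        using f1 f2 2 hyperbola by simp
      moreover have "1 / n2 \<noteq> 0" using 2 by simp
      ultimately have ?f2 using pole2 2 by blast
      then show ?thesis by blast
    next
      case 3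
      have "1 / m2 \<noteq> 0" using f2[OF p] 3 assms(11) p by auto
      moreover have "\<forall>x\<in>I. f2 x = 1 / m2 \<and> f1 x = (1 / n1) / (x $ 2 - (- m1 / n1))"
        using f1 f2 3 hyperbola by simp
      moreover have "1 / n1 \<noteq> 0" using 3 by simp
      ultimately have ?f1 using pole1 3 by blast
      then show ?thesis by blast
    qed
  qed
qed

end
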